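(* For every sequence $(m_n)_{n\in\mathbb N}$ of positive integers with $\lim_{n\to\infty} m_n=\infty$ there exists a non-increasing sequence $(a_n)_{n\in\mathbb N}$ of positive real numbers with $\sum_{n=1}^\infty a_n<\infty$ such that the achievement set $E(a_n)$ is a Cantorval and $$\lim_{n\to\infty}\frac{\operatorname{card}\{i\in\mathbb N:\ i\le n,\ a_i\le r_i\}}{m_n}=0,$$ where $r_i:=\sum_{j>i}a_j$.
   Context: $\mathbb N=\{1,2,3,\ldots\}$. For a sequence $(a_n)_{n\in\mathbb N}$ of non-negative real numbers with $\sum a_n$ convergent, its achievement set (set of subsums) is $$E(a_n):=\Bigl\{x\in\mathbb R:\ \exists A\subset\mathbb N\ \ x=\sum_{n\in A}a_n\Bigr\}$$ (the empty sum is $0$). A Cantor set is a set homeomorphic to the classic ternary Cantor set. A Cantorval is a bounded, regularly closed subset of $\mathbb R$ (i.e. a set equal to the closure of its interior) whose boundary is a Cantor set. *)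

theory Defs
  imports "HOL-Analysis.Analysis"
begin

(* Sequences are functions on nat of which only the values at indices >= 1 matter;
   the value at 0 is junk and must never enter a definition. *)

definition achievement_set :: "(nat \<Rightarrow> real) \<Rightarrow> real set" where
  "achievement_set a = {x. \<exists>A. A \<subseteq> {1..} \<and> (a has_sum x) A}"

definition tail_sum :: "(nat \<Rightarrow> real) \<Rightarrow> nat \<Rightarrow> real" where
  "tail_sum a i = (\<Sum>\<^sub>\<infinity>j\<in>{i<..}. a j)"

(* Removing open middle thirds: the next stage consists of two copies of the
   current one, scaled by 1/3 and placed in [0,1/3] and [2/3,1]. *)
fun cantor_stage :: "nat \<Rightarrow> real set" where
  "cantor_stage 0 = {0..1}"
| "cantor_stage (Suc n) = (\<lambda>x. x / 3) ` cantor_stage n \<union> (\<lambda>x. 2 / 3 + x / 3) ` cantor_stage n"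

definition ternary_cantor_set :: "real set" where
  "ternary_cantor_set = (\<Inter>n. cantor_stage n)"

definition is_cantor_set :: "'a::topological_space set \<Rightarrow> bool" where
  "is_cantor_set S \<longleftrightarrow> S homeomorphic ternary_cantor_set"

definition is_cantorval :: "real set \<Rightarrow> bool" where
  "is_cantorval S \<longleftrightarrow> bounded S \<and> S = closure (interior S) \<and> is_cantor_set (frontier S)"

end

theory Submission
  imports Defs
begin

text \<open>The witness is \<open>a i = 5 / 2 ^ i\<close>, except that \<open>a i = 3 / 2 ^ i\<close> for \<open>i\<close> in an infinite, very sparse
  set \<open>B\<close>. If \<open>i \<notin> B\<close>, then the tail after \<open>i\<close> is strictly below \<open>5 / 2 ^ i = a i\<close>, so the Kakeya
  condition can hold only on \<open>B\<close>. As 3 and 5 are odd, the finite subsums represent every dyadic number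
  modulo 1; hence finitely many integer translates of the compact achievement set \<open>E\<close> cover \<open>[0, 1]\<close>,
  and \<open>E\<close> has interior points.

  Since \<open>E\<close> is a finite union of translates of the subsums of each tail, these sets have interior too and
  are small, so \<open>E\<close> is regularly closed. The indices with \<open>a i > r i\<close> produce gaps of the tails
  arbitrarily close to 0, which prevents isolated points of the boundary. The boundary is thus compact,
  perfect and without interior, and such subsets of the line are homeomorphic to binary sequences by
  repeatedly splitting along a gap that meets the middle third.\<close>

section \<open>Cantor sets on the real line\<close>

lemma compact_UNIV_bool_seq: "compact (UNIV :: (nat \<Rightarrow> bool) set)"
proof -
  have "compact_space (product_topology (\<lambda>i::nat. euclidean :: bool topology) UNIV)"
    by (intro iffD2[OF compact_space_product_topology] disjI2 ballI)
       (simp add: compact_space_def finite_imp_compact)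
  then show ?thesis
    by (simp add: euclidean_product_topology compact_space_def)
qed

text \<open>The sequences agreeing with \<open>b\<close> below \<open>n\<close> form an open
  neighbourhood of \<open>b\<close> in the product topology, so \<open>w\<close> acts as a modulus
  of continuity. This serves both the coding of perfect sets and the compactness of sets of
  subsums.\<close>

lemma continuous_on_bool_seq:
  fixes f :: "(nat \<Rightarrow> bool) \<Rightarrow> real"
  assumes "\<And>n b c. \<forall>i<n. b i = c i \<Longrightarrow> \<bar>f b - f c\<bar> \<le> w n" and "w \<longlonglongrightarrow> 0"
  shows "continuous_on UNIV f"
proof -
  have "\<forall>\<^sub>F c in at b. dist (f c) (f b) < e" if e: "0 < e" for b e
  proof -
    obtain n where n: "w n < e"
      using order_tendstoD(2)[OF assms(2) e] by (metis eventually_sequentially order_refl)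
    define S where "S = Pi\<^sub>E UNIV (\<lambda>i. if i < n then {b i} else UNIV)"
    have "finite {i. (if i < n then {b i} else UNIV) \<noteq> UNIV}"
      by (rule finite_subset[of _ "{..<n}"]) auto
    then have "open S"
      unfolding S_def by (intro open_PiE) (auto simp: open_discrete)
    moreover have "b \<in> S" by (auto simp: S_def)
    moreover have "dist (f c) (f b) < e" if "c \<in> S" for c
    proof -
      have "\<forall>i<n. c i = b i" using that by (auto simp: S_def PiE_iff split: if_splits)
      then show ?thesis using assms(1)[of n c b] n by (simp add: dist_real_def)
    qed
    ultimately show ?thesis unfolding eventually_at_topological by blast
  qed
  then show ?thesis
    unfolding continuous_on_def tendsto_iff by blast
qed

text \<open>One-sided accumulation at the end points is what makes the pieces on both sides of a gap
  splittable again.\<close>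
definition cantor_piece :: "real set \<Rightarrow> real \<Rightarrow> real \<Rightarrow> bool" where
  "cantor_piece C l r \<longleftrightarrow> l \<in> C \<and> r \<in> C \<and> l < r \<and> l islimpt (C \<inter> {l<..}) \<and> r islimpt (C \<inter> {..<r})"

text \<open>Points of \<open>C\<close> to the right of \<open>p\<close> stay at distance at least
  \<open>q - p\<close>, so only the left side can accumulate at \<open>p\<close>.\<close>

lemma islimpt_left_of_gap:
  fixes p q :: real
  assumes "p islimpt C" "p < q" "C \<inter> {p<..<q} = {}"
  shows "p islimpt (C \<inter> {..<p})"
proof -
  have "C \<subseteq> (C \<inter> {..<p}) \<union> ({p} \<union> {q..})" using assms(3) by force
  then have "p islimpt (C \<inter> {..<p}) \<or> p islimpt ({p} \<union> {q..})"
    using assms(1) islimpt_subset islimpt_Un by blast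
  moreover have "\<not> p islimpt {q..}" using assms(2) closed_limpt[of "{q..}"] by auto
  ultimately show ?thesis by (simp add: islimpt_insert)
qed

lemma islimpt_right_of_gap:
  fixes p q :: real
  assumes "q islimpt C" "p < q" "C \<inter> {p<..<q} = {}"
  shows "q islimpt (C \<inter> {q<..})"
proof -
  have "C \<subseteq> (C \<inter> {q<..}) \<union> ({q} \<union> {..p})" using assms(3) by force
  then have "q islimpt (C \<inter> {q<..}) \<or> q islimpt ({q} \<union> {..p})"
    using assms(1) islimpt_subset islimpt_Un by blast
  moreover have "\<not> q islimpt {..p}" using assms(2) closed_limpt[of "{..p}"] by auto
  ultimately show ?thesis by (simp add: islimpt_insert)
qed

text \<open>Empty interior supplies a point \<open>x\<close> of the middle third outside
  \<open>C\<close>; \<open>p\<close> and \<open>q\<close> are the points of \<open>C\<close> nearest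
  to \<open>x\<close> on either side. As \<open>x\<close> is in the middle third, neither remaining
  piece exceeds two thirds of the length.\<close>

lemma cantor_piece_split:
  assumes "closed C" "interior C = {}" "\<And>x. x \<in> C \<Longrightarrow> x islimpt C" "cantor_piece C l r"
  shows "\<exists>p q. cantor_piece C l p \<and> cantor_piece C q r \<and> p < q \<and> C \<inter> {p<..<q} = {} \<and>
           p - l \<le> 2/3 * (r - l) \<and> r - q \<le> 2/3 * (r - l)"
proof -
  have lr: "l \<in> C" "r \<in> C" "l < r" "l islimpt (C \<inter> {l<..})" "r islimpt (C \<inter> {..<r})"
    using assms(4) by (auto simp: cantor_piece_def)
  let ?m = "{l + (r - l)/3 <..< r - (r - l)/3}"
  have "l + (r - l)/3 < r - (r - l)/3" using \<open>l < r\<close> by argo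
  then have "?m \<noteq> {}" by simp
  moreover have "?m \<subseteq> interior C" if "?m \<subseteq> C" using that by (intro interior_maximal) auto
  ultimately obtain x where x: "x \<in> ?m" "x \<notin> C" using assms(2) by blast
  have xl: "l < x" "x < r" using x(1) lr(3) by (simp_all add: field_simps)
  have "compact (C \<inter> {l..x})" "l \<in> C \<inter> {l..x}" "compact (C \<inter> {x..r})" "r \<in> C \<inter> {x..r}"
    using assms(1) xl lr by (auto intro: closed_Int_compact)
  then obtain p q where p: "p \<in> C \<inter> {l..x}" "\<And>y. y \<in> C \<inter> {l..x} \<Longrightarrow> y \<le> p"
    and q: "q \<in> C \<inter> {x..r}" "\<And>y. y \<in> C \<inter> {x..r} \<Longrightarrow> q \<le> y"
    by (metis compact_attains_inf compact_attains_sup empty_iff)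
  have pxq: "p < x" "x < q" using p(1) q(1) x(2) by (auto simp: less_le)
  have gap: "C \<inter> {p<..<q} = {}"
  proof -
    have False if "y \<in> C" "p < y" "y < q" for y
      using p(1) p(2)[of y] q(1) q(2)[of y] that by (cases "y \<le> x") auto
    then show ?thesis by auto
  qed
  \<comment> \<open>One-sided accumulation puts further points of \<open>C\<close> between
    \<open>l\<close> and \<open>x\<close> and between \<open>x\<close> and \<open>r\<close>, so
    neither new piece degenerates to a point.\<close>
  have "\<exists>y\<in>C \<inter> {l<..}. y \<noteq> l \<and> dist y l < x - l" "\<exists>y\<in>C \<inter> {..<r}. y \<noteq> r \<and> dist y r < r - x"
    using lr(4,5) xl by (simp_all add: islimpt_approachable del: Int_iff)
  then obtain y z where yz: "y \<in> C" "l < y" "y < x" "z \<in> C" "z < r" "x < z"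
    by (auto simp: dist_real_def)
  have "l < p" "q < r" using yz p(2)[of y] q(2)[of z] by auto
  moreover have "p islimpt (C \<inter> {..<p})" "q islimpt (C \<inter> {q<..})"
    using islimpt_left_of_gap[of p C q] islimpt_right_of_gap[of q C p] gap pxq p(1) q(1) assms(3)
    by auto
  moreover have "p - l \<le> 2/3 * (r - l)" "r - q \<le> 2/3 * (r - l)"
    using x(1) pxq by (auto simp: field_simps)
  ultimately show ?thesis
    using p(1) q(1) lr gap pxq by (intro exI[of _ p] exI[of _ q]) (auto simp: cantor_piece_def)
qed

text \<open>Repeated splitting yields a binary tree of pieces, and each branch is sent to the only
  point common to its pieces. A continuous bijection from a compact space onto a subset of the line
  is a homeomorphism.\<close>

lemma perfect_homeomorphic_bool_seq:
  fixes C :: "real set"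
  assumes "compact C" "C \<noteq> {}" "interior C = {}" and perfect: "\<And>x. x \<in> C \<Longrightarrow> x islimpt C"
  shows "(UNIV :: (nat \<Rightarrow> bool) set) homeomorphic C"
proof -
  have "closed C" using assms(1) by (rule compact_imp_closed)
  note split = cantor_piece_split[OF this assms(3) perfect]
  have "\<exists>P Q. \<forall>l r. cantor_piece C l r \<longrightarrow> cantor_piece C l (P l r) \<and> cantor_piece C (Q l r) r \<and>
      P l r < Q l r \<and> C \<inter> {P l r<..<Q l r} = {} \<and>
      P l r - l \<le> 2/3 * (r - l) \<and> r - Q l r \<le> 2/3 * (r - l)"
    using split by metis
  then obtain P Q where
        P: "\<And>l r. cantor_piece C l r \<Longrightarrow> cantor_piece C l (P l r)"
    and Q: "\<And>l r. cantor_piece C l r \<Longrightarrow> cantor_piece C (Q l r) r"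
    and PQ: "\<And>l r. cantor_piece C l r \<Longrightarrow> P l r < Q l r"
    and gap: "\<And>l r. cantor_piece C l r \<Longrightarrow> C \<inter> {P l r<..<Q l r} = {}"
    and wP: "\<And>l r. cantor_piece C l r \<Longrightarrow> P l r - l \<le> 2/3 * (r - l)"
    and wQ: "\<And>l r. cantor_piece C l r \<Longrightarrow> r - Q l r \<le> 2/3 * (r - l)"
    by blast
  obtain l0 where l0: "l0 \<in> C" "\<And>x. x \<in> C \<Longrightarrow> l0 \<le> x"
    using compact_attains_inf[OF assms(1,2)] by blast
  obtain r0 where r0: "r0 \<in> C" "\<And>x. x \<in> C \<Longrightarrow> x \<le> r0"
    using compact_attains_sup[OF assms(1,2)] by blast
  have "\<exists>x\<in>C. x \<noteq> l0" using perfect[OF l0(1)] by (meson islimpt_approachable zero_less_one)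
  then have "l0 < r0" using l0 r0 by force
  \<comment> \<open>Below the minimum and above the maximum there are artificial gaps of length
    1.\<close>
  moreover have "l0 islimpt (C \<inter> {l0<..})"
    using l0 by (intro islimpt_right_of_gap[of _ _ "l0 - 1"] perfect) force+
  moreover have "r0 islimpt (C \<inter> {..<r0})"
    using r0 by (intro islimpt_left_of_gap[of _ _ "r0 + 1"] perfect) force+
  ultimately have piece0: "cantor_piece C l0 r0" using l0 r0 by (simp add: cantor_piece_def)

  \<comment> \<open>\<open>J b n\<close> holds the end points of the piece reached after the first
    \<open>n\<close> choices; \<open>True\<close> selects the right-hand piece.\<close>
  define J :: "(nat \<Rightarrow> bool) \<Rightarrow> nat \<Rightarrow> real \<times> real" where
    "J b = rec_nat (l0, r0) (\<lambda>n (l, r). if b n then (Q l r, r) else (l, P l r))" for b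
  define L R where "L b n = fst (J b n)" and "R b n = snd (J b n)" for b n
  have L0: "L b 0 = l0" and R0: "R b 0 = r0"
    and LSuc: "L b (Suc n) = (if b n then Q (L b n) (R b n) else L b n)"
    and RSuc: "R b (Suc n) = (if b n then R b n else P (L b n) (R b n))" for b n
    by (simp_all add: L_def R_def J_def case_prod_unfold)
  have piece: "cantor_piece C (L b n) (R b n)" for b n
    by (induction n) (simp_all add: L0 R0 LSuc RSuc piece0 P Q)
  define W where "W n = (2/3) ^ n * (r0 - l0)" for n
  have W: "R b n - L b n \<le> W n" for b n
  proof (induction n)
    case (Suc n)
    have "R b (Suc n) - L b (Suc n) \<le> 2/3 * (R b n - L b n)"
      using wP[OF piece] wQ[OF piece] by (simp add: LSuc RSuc)
    also have "\<dots> \<le> W (Suc n)" using Suc by (simp add: W_def)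
    finally show ?case .
  qed (simp add: L0 R0 W_def)
  have W_lim: "W \<longlonglongrightarrow> 0" unfolding W_def by (intro tendsto_mult_left_zero LIMSEQ_realpow_zero) auto
  have LR: "L b n < R b n" for b n using piece by (auto simp: cantor_piece_def)
  have L_step: "L b n \<le> L b (Suc n)" and R_step: "R b (Suc n) \<le> R b n" for b n
    using P[OF piece, of b n] Q[OF piece, of b n] PQ[OF piece, of b n]
    by (auto simp: LSuc RSuc cantor_piece_def)
  have L_mono: "m \<le> n \<Longrightarrow> L b m \<le> L b n" and R_mono: "m \<le> n \<Longrightarrow> R b n \<le> R b m" for b m n
    using lift_Suc_mono_le[of "L b"] lift_Suc_antimono_le[of "R b"] L_step R_step by blast+
  have L_le_R: "L b m \<le> R b n" for b m n
    using L_mono[of m "max m n" b] R_mono[of n "max m n" b] LR[of b "max m n"] by linarith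
  define f where "f b = (SUP n. L b n)" for b
  have bdd: "bdd_above (range (L b))" for b using L_le_R[of b _ 0] by (auto intro!: bdd_aboveI)
  have Lf: "L b n \<le> f b" and fR: "f b \<le> R b n" for b n
    using L_le_R by (auto simp: f_def intro!: cSUP_upper cSUP_least bdd)
  have f_eqI: "x = f b" if "\<And>n. L b n \<le> x \<and> x \<le> R b n" for x b
  proof -
    have "\<bar>x - f b\<bar> \<le> W n" for n using that[of n] Lf[of b n] fR[of b n] W[of b n] by linarith
    then have "\<bar>x - f b\<bar> \<le> 0" by (intro LIMSEQ_le_const[OF W_lim]) auto
    then show ?thesis by simp
  qed
  have agree: "L b n = L c n \<and> R b n = R c n" if "\<forall>i<n. b i = c i" for b c n
    using that by (induction n) (simp_all add: L0 R0 LSuc RSuc)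

  have "f b \<in> C" for b
  proof -
    have "\<exists>y\<in>C. dist y (f b) < e" if e: "e > 0" for e
    proof -
      obtain n where "W n < e"
        using order_tendstoD(2)[OF W_lim e] by (metis eventually_sequentially order_refl)
      then have "dist (L b n) (f b) < e"
        using Lf[of b n] fR[of b n] W[of b n] by (simp add: dist_real_def)
      then show ?thesis using piece[of b n] by (auto simp: cantor_piece_def)
    qed
    then show ?thesis using closed_approachable[OF \<open>closed C\<close>] by blast
  qed
  moreover have "x \<in> range f" if "x \<in> C" for x
  proof -
    \<comment> \<open>The choices leading to \<open>x\<close> depend on the pieces already chosen,
      so the pieces \<open>K\<close> are built from \<open>x\<close> first and the branch
      \<open>b\<close> is read off them.\<close>
    define K where "K = rec_nat (l0, r0) (\<lambda>n (l, r). if Q l r \<le> x then (Q l r, r) else (l, P l r))"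
    define b where "b n = (case K n of (l, r) \<Rightarrow> Q l r \<le> x)" for n
    have JK: "J b n = K n" for n
      by (induction n) (simp_all add: J_def K_def b_def split: prod.split)
    have b: "b n \<longleftrightarrow> Q (L b n) (R b n) \<le> x" for n
      by (simp add: L_def R_def JK) (simp add: b_def case_prod_unfold)
    have "L b n \<le> x \<and> x \<le> R b n" for n
    proof (induction n)
      case 0
      then show ?case using l0 r0 that by (simp add: L0 R0)
    next
      case (Suc n)
      then show ?case using b[of n] gap[OF piece, of b n] that by (auto simp: LSuc RSuc)
    qed
    then show ?thesis using f_eqI by blast
  qed
  moreover have "inj f"
  proof
    fix b c assume eq: "f b = f c"
    show "b = c"
    proof (rule ccontr)
      assume "b \<noteq> c"
      then have ex: "\<exists>n. b n \<noteq> c n" by auto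
      \<comment> \<open>At the first difference the branches enter opposite sides of the same gap,
        which separates the values of \<open>f\<close>.\<close>
      define n where "n = (LEAST n. b n \<noteq> c n)"
      have ne: "b n \<noteq> c n" and "\<forall>i<n. b i = c i"
        unfolding n_def using LeastI_ex[OF ex] not_less_Least by blast+
      from agree[OF this(2)] have "L b n = L c n" "R b n = R c n" by auto
      then show False
        using ne eq PQ[OF piece, of c n] Lf[of b "Suc n"] fR[of b "Suc n"] Lf[of c "Suc n"] fR[of c "Suc n"]
        by (auto simp: LSuc RSuc split: if_splits)
    qed
  qed
  moreover have "continuous_on UNIV f"
  proof (rule continuous_on_bool_seq[OF _ W_lim])
    fix n and b c :: "nat \<Rightarrow> bool" assume "\<forall>i<n. b i = c i"
    then show "\<bar>f b - f c\<bar> \<le> W n"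
      using agree[of n b c] Lf[of b n] fR[of b n] Lf[of c n] fR[of c n] W[of b n] by (simp add: abs_le_iff)
  qed
  ultimately show ?thesis
    by (intro homeomorphic_compact[OF compact_UNIV_bool_seq]) auto
qed

section \<open>The ternary Cantor set: closed, perfect, without interior\<close>

lemma closed_cantor_stage: "closed (cantor_stage n)"
proof (induction n)
  case (Suc n)
  have "closed ((\<lambda>x. x / 3) ` cantor_stage n)" "closed ((\<lambda>x. 2/3 + x / 3) ` cantor_stage n)"
    using closed_scaling[OF Suc, of "1/3"] closed_translation[OF closed_scaling[OF Suc, of "1/3"], of "2/3"]
    by (simp_all add: image_image)
  then show ?case by (simp add: closed_Un)
qed simp

lemma cantor_stage_subset: "cantor_stage n \<subseteq> {0..1}"
  by (induction n) (auto simp: subset_iff)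

lemma ternary_cantor_set_eq:
  "ternary_cantor_set = (\<lambda>x. x / 3) ` ternary_cantor_set \<union> (\<lambda>x. 2 / 3 + x / 3) ` ternary_cantor_set"
proof (intro equalityI subsetI)
  fix x assume x: "x \<in> ternary_cantor_set"
  then have "x \<in> cantor_stage (Suc n)" for n unfolding ternary_cantor_set_def by blast
  then have st: "3 * x \<in> cantor_stage n \<or> 3 * x - 2 \<in> cantor_stage n" for n by force
  \<comment> \<open>The alternative in \<open>st\<close> might vary with \<open>n\<close>. Since
    \<open>3 * x\<close> and \<open>3 * x - 2\<close> cannot both lie in [0, 1], comparing
    \<open>3 * x\<close> with 1 settles it for all stages at once.\<close>
  have "3 * x \<in> ternary_cantor_set \<or> 3 * x - 2 \<in> ternary_cantor_set"
  proof (cases "3 * x \<le> 1")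
    case True
    then have "3 * x \<in> cantor_stage n" for n using st[of n] cantor_stage_subset[of n] by force
    then show ?thesis by (simp add: ternary_cantor_set_def)
  next
    case False
    then have "3 * x - 2 \<in> cantor_stage n" for n using st[of n] cantor_stage_subset[of n] by force
    then show ?thesis by (simp add: ternary_cantor_set_def)
  qed
  then show "x \<in> (\<lambda>x. x / 3) ` ternary_cantor_set \<union> (\<lambda>x. 2 / 3 + x / 3) ` ternary_cantor_set"
    using image_eqI[of x "\<lambda>x. x / 3" "3 * x"] image_eqI[of x "\<lambda>x. 2 / 3 + x / 3" "3 * x - 2"]
    by (elim disjE) (simp_all add: diff_divide_distrib)
next
  fix x assume x: "x \<in> (\<lambda>x. x / 3) ` ternary_cantor_set \<union> (\<lambda>x. 2 / 3 + x / 3) ` ternary_cantor_set"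
  have "x \<in> cantor_stage n" for n
  proof (cases n)
    case 0
    have "ternary_cantor_set \<subseteq> {0..1}" using cantor_stage_subset ternary_cantor_set_def by blast
    then show ?thesis using 0 x by fastforce
  next
    case (Suc k)
    then show ?thesis using x unfolding ternary_cantor_set_def by fastforce
  qed
  then show "x \<in> ternary_cantor_set" by (simp add: ternary_cantor_set_def)
qed

lemma ternary_cantor_set_iff:
  "x \<in> ternary_cantor_set \<longleftrightarrow> (\<exists>u\<in>ternary_cantor_set. x = u / 3 \<or> x = 2 / 3 + u / 3)"
  by (subst ternary_cantor_set_eq) blast

lemma ternary_cantor_set_subset: "ternary_cantor_set \<subseteq> {0..1}"
  using cantor_stage_subset ternary_cantor_set_def by blast

lemma zero_one_in_ternary_cantor_set: "0 \<in> ternary_cantor_set" "1 \<in> ternary_cantor_set"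
proof -
  have "0 \<in> cantor_stage n \<and> 1 \<in> cantor_stage n" for n
    by (induction n) (auto intro: image_eqI[of _ _ 0] image_eqI[of _ _ 1])
  then show "0 \<in> ternary_cantor_set" "1 \<in> ternary_cantor_set"
    by (auto simp: ternary_cantor_set_def)
qed

text \<open>Every point has a companion within distance 1, namely 0 or 1; each use of
  self-similarity divides this distance by 3.\<close>

lemma islimpt_ternary_cantor_set:
  assumes "x \<in> ternary_cantor_set"
  shows "x islimpt ternary_cantor_set"
proof -
  have ex: "\<exists>y\<in>ternary_cantor_set. y \<noteq> x \<and> \<bar>y - x\<bar> \<le> (1/3) ^ n" if "x \<in> ternary_cantor_set" for n x
    using that
  proof (induction n arbitrary: x)
    case 0
    then show ?case using ternary_cantor_set_subset zero_one_in_ternary_cantor_set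
      by (cases "x = 0") (force intro: bexI[of _ 0] bexI[of _ 1])+
  next
    case (Suc n)
    then obtain u c where uc: "u \<in> ternary_cantor_set" "x = c + u / 3" "c = 0 \<or> c = 2/3"
      using ternary_cantor_set_iff by (metis add_0)
    obtain v where v: "v \<in> ternary_cantor_set" "v \<noteq> u" "\<bar>v - u\<bar> \<le> (1/3) ^ n"
      using Suc.IH[OF uc(1)] by blast
    have "c + v / 3 \<in> ternary_cantor_set" using uc(3) v(1) ternary_cantor_set_iff by (metis add_0)
    moreover have "\<bar>(c + v/3) - x\<bar> = \<bar>v - u\<bar> / 3" using uc(2) by (simp add: field_simps)
    ultimately show ?case using v uc(2) by (intro bexI[of _ "c + v/3"]) auto
  qed
  show ?thesis unfolding islimpt_approachable
  proof (intro allI impI)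
    fix e :: real assume "0 < e"
    then obtain n where "(1/3) ^ n < e" using real_arch_pow_inv[of e "1/3"] by auto
    then show "\<exists>y\<in>ternary_cantor_set. y \<noteq> x \<and> dist y x < e"
      using ex[OF assms, of n] by (fastforce simp: dist_real_def)
  qed
qed

text \<open>Members more than \<open>(1/3) ^ n\<close> apart have a non-member between them: if both
  lie in the same outer third, rescale by 3 and use induction; otherwise 1/2 separates them.\<close>

lemma interior_ternary_cantor_set: "interior ternary_cantor_set = {}"
proof -
  have ex: "\<exists>z. x < z \<and> z < y \<and> z \<notin> ternary_cantor_set"
    if "x \<in> ternary_cantor_set" "y \<in> ternary_cantor_set" "(1/3) ^ n < y - x" for x y n
    using that
  proof (induction n arbitrary: x y)
    case 0
    then have "0 \<le> x" "y \<le> 1" using ternary_cantor_set_subset by auto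
    then show ?case using 0 by simp
  next
    case (Suc n)
    from Suc.prems obtain u c where uc: "u \<in> ternary_cantor_set" "x = c + u / 3" "c = 0 \<or> c = 2/3"
      using ternary_cantor_set_iff by (metis add_0)
    from Suc.prems obtain v d where vd: "v \<in> ternary_cantor_set" "y = d + v / 3" "d = 0 \<or> d = 2/3"
      using ternary_cantor_set_iff by (metis add_0)
    have uv: "0 \<le> u" "u \<le> 1" "0 \<le> v" "v \<le> 1" using uc vd ternary_cantor_set_subset by auto
    have "0 < (1/3 :: real) ^ Suc n" by simp
    then have pos: "x < y" using Suc.prems(3) by linarith
    show ?case
    proof (cases "c = d")
      case True
      then have "(1/3) ^ n < v - u" using Suc.prems(3) uc vd by (simp add: field_simps)
      then obtain z where z: "u < z" "z < v" "z \<notin> ternary_cantor_set"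
        using Suc.IH uc(1) vd(1) by blast
      have zb: "0 < z" "z < 1" using z uv by auto
      have "c + z / 3 \<notin> ternary_cantor_set"
      proof
        assume "c + z / 3 \<in> ternary_cantor_set"
        then obtain w e where we: "w \<in> ternary_cantor_set" "c + z / 3 = e + w / 3" "e = 0 \<or> e = 2/3"
          using ternary_cantor_set_iff by (metis add_0)
        have "0 \<le> w" "w \<le> 1" using we ternary_cantor_set_subset by auto
        then have "w = z" using we uc(3) zb by (auto simp: field_simps)
        then show False using we z by simp
      qed
      then show ?thesis using z uc vd True by (intro exI[of _ "c + z/3"]) auto
    next
      case False
      then have "c = 0" "d = 2/3" using uc vd pos uv by auto
      then have "x < 1/2" "1/2 < y" using uc vd uv by auto
      moreover have "1/2 \<notin> ternary_cantor_set"
      proof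
        assume "1/2 \<in> ternary_cantor_set"
        then obtain w e where we: "w \<in> ternary_cantor_set" "1/2 = e + w / (3::real)" "e = 0 \<or> e = 2/3"
          using ternary_cantor_set_iff by (metis add_0)
        then show False using ternary_cantor_set_subset by force
      qed
      ultimately show ?thesis by blast
    qed
  qed
  show ?thesis
  proof (rule ccontr)
    assume "interior ternary_cantor_set \<noteq> {}"
    then obtain x where "x \<in> interior ternary_cantor_set" by blast
    then obtain e where e: "e > 0" "cball x e \<subseteq> ternary_cantor_set"
      using mem_interior_cball by blast
    obtain n where "(1/3) ^ n < e" using real_arch_pow_inv[OF e(1), of "1/3"] by auto
    then obtain z where "x < z" "z < x + e" "z \<notin> ternary_cantor_set"
      using ex[of x "x + e" n] e by (auto simp: subset_iff dist_real_def)
    then show False using e(2) by (auto simp: subset_iff dist_real_def)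
  qed
qed

text \<open>Both \<open>C\<close> and the ternary set are homeomorphic to the space of binary
  sequences.\<close>

lemma is_cantor_setI:
  fixes C :: "real set"
  assumes "compact C" "C \<noteq> {}" "interior C = {}" "\<And>x. x \<in> C \<Longrightarrow> x islimpt C"
  shows "is_cantor_set C"
proof -
  have "closed ternary_cantor_set"
    unfolding ternary_cantor_set_def by (intro closed_INT ballI closed_cantor_stage)
  then have "compact ternary_cantor_set"
    by (metis compact_Icc compact_Int_closed inf.absorb_iff2 ternary_cantor_set_subset)
  then have "(UNIV :: (nat \<Rightarrow> bool) set) homeomorphic ternary_cantor_set"
    using zero_one_in_ternary_cantor_set interior_ternary_cantor_set islimpt_ternary_cantor_set
    by (intro perfect_homeomorphic_bool_seq) auto
  moreover have "C homeomorphic (UNIV :: (nat \<Rightarrow> bool) set)"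
    by (rule iffD1[OF homeomorphic_sym perfect_homeomorphic_bool_seq[OF assms]])
  ultimately show ?thesis
    unfolding is_cantor_set_def using homeomorphic_trans by blast
qed

section \<open>Achievement sets of non-negative series\<close>

text \<open>Finitely many closed sets without interior have a union without interior. The lemma
  passes interior points from the achievement set to its tails, and from a union of integer
  translates to the achievement set.\<close>

lemma interior_translates:
  fixes S :: "real set"
  assumes "finite X" "closed S" "interior (\<Union>x\<in>X. (+) x ` S) \<noteq> {}"
  shows "interior S \<noteq> {}"
  using assms(1,3)
proof (induction X)
  case (insert x X)
  show ?case
  proof (cases "interior (\<Union>x\<in>X. (+) x ` S) = {}")
    case True
    then have "interior ((+) x ` S \<union> (\<Union>x\<in>X. (+) x ` S)) = interior ((+) x ` S)"
      by (intro interior_closed_Un_empty_interior closed_translation assms(2))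
    then show ?thesis using insert.prems by (simp add: interior_translation)
  next
    case False
    then show ?thesis using insert.IH by blast
  qed
qed simp

locale nonneg_series =
  fixes a :: "nat \<Rightarrow> real"
  assumes nonneg: "0 \<le> a n" and summable: "a summable_on UNIV"
begin

definition subsums :: "nat \<Rightarrow> real set" where
  "subsums n = infsum a ` Pow {n..}"

text \<open>Unlike in \<open>tail_sum\<close>, the index \<open>n\<close> itself is included. This
  is the largest element of \<open>subsums n\<close>.\<close>

definition remainder :: "nat \<Rightarrow> real" where
  "remainder n = infsum a {n..}"

lemma summable_on_any: "a summable_on A"
  using summable summable_on_subset_banach by blast

lemma achievement_set_eq: "achievement_set a = subsums 1"
proof -
  have "(a has_sum x) A \<longleftrightarrow> x = infsum a A" for x A
    using summable_on_any[of A] by (auto simp: has_sum_iff)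
  then show ?thesis unfolding achievement_set_def subsums_def by auto
qed

lemma tail_sum_eq: "tail_sum a i = remainder (Suc i)"
  by (simp add: tail_sum_def remainder_def atLeast_Suc_greaterThan)

lemma infsum_split: "infsum a A = sum a (A \<inter> {..<n}) + infsum a (A \<inter> {n..})"
proof -
  have "infsum a ((A \<inter> {..<n}) \<union> (A \<inter> {n..})) = infsum a (A \<inter> {..<n}) + infsum a (A \<inter> {n..})"
    by (intro infsum_Un_disjoint summable_on_any) auto
  moreover have "(A \<inter> {..<n}) \<union> (A \<inter> {n..}) = A" by auto
  ultimately show ?thesis by simp
qed

lemma infsum_mono_set: "A \<subseteq> B \<Longrightarrow> infsum a A \<le> infsum a B"
  by (intro infsum_mono2 summable_on_any) (auto simp: nonneg)

lemma subsums_bounds: "x \<in> subsums n \<Longrightarrow> 0 \<le> x \<and> x \<le> remainder n"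
  by (auto simp: subsums_def remainder_def nonneg intro: infsum_nonneg infsum_mono_set)

lemma remainder_nonneg: "0 \<le> remainder n"
  by (simp add: remainder_def infsum_nonneg nonneg)

lemma remainder_tendsto_zero: "remainder \<longlonglongrightarrow> 0"
proof -
  have "(\<lambda>n. sum a {..<n}) \<longlonglongrightarrow> infsum a UNIV"
    using has_sum_imp_sums[OF has_sum_infsum[OF summable]] by (simp add: sums_def)
  then have "(\<lambda>n. infsum a UNIV - sum a {..<n}) \<longlonglongrightarrow> infsum a UNIV - infsum a UNIV"
    by (intro tendsto_diff tendsto_const)
  moreover have "remainder n = infsum a UNIV - sum a {..<n}" for n
    using infsum_split[of UNIV n] by (simp add: remainder_def)
  then have "remainder = (\<lambda>n. infsum a UNIV - sum a {..<n})" by blast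
  ultimately show ?thesis by simp
qed

lemma obtain_remainder_less:
  assumes "0 < e"
  obtains n where "1 \<le> n" "remainder n < e"
  using order_tendstoD(2)[OF remainder_tendsto_zero assms]
  by (metis eventually_sequentially max.cobounded1 max.cobounded2)

text \<open>The set is a continuous image of the binary sequences, because altering the choices from
  \<open>m\<close> on moves the sum by at most \<open>remainder m\<close>.\<close>

lemma compact_subsums: "compact (subsums n)"
proof -
  define f where "f b = infsum a ({i. b i} \<inter> {n..})" for b
  have "continuous_on UNIV f"
  proof (rule continuous_on_bool_seq[OF _ remainder_tendsto_zero])
    fix m and b c :: "nat \<Rightarrow> bool" assume eq: "\<forall>i<m. b i = c i"
    \<comment> \<open>Used for \<open>b\<close> and for \<open>c\<close> itself, this places both
      values in one interval of length \<open>remainder m\<close>.\<close>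
    have "\<exists>u. f b = sum a ({i. c i} \<inter> {n..} \<inter> {..<m}) + u \<and> 0 \<le> u \<and> u \<le> remainder m"
      if "\<forall>i<m. b i = c i" for b c
    proof -
      have "{i. b i} \<inter> {n..} \<inter> {..<m} = {i. c i} \<inter> {n..} \<inter> {..<m}" using that by auto
      moreover have "infsum a ({i. b i} \<inter> {n..} \<inter> {m..}) \<le> remainder m"
        unfolding remainder_def by (intro infsum_mono_set) auto
      moreover have "0 \<le> infsum a ({i. b i} \<inter> {n..} \<inter> {m..})"
        by (intro infsum_nonneg nonneg)
      ultimately show ?thesis
        unfolding f_def using infsum_split[of "{i. b i} \<inter> {n..}" m] by metis
    qed
    from this[of b c] this[of c c] eq show "\<bar>f b - f c\<bar> \<le> remainder m" by fastforce
  qed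
  then have "compact (range f)"
    using compact_UNIV_bool_seq compact_continuous_image by blast
  moreover have "range f = subsums n"
  proof -
    have "f b \<in> subsums n" for b
      unfolding f_def subsums_def by (rule imageI) simp
    moreover have "infsum a A = f (\<lambda>i. i \<in> A)" if "A \<subseteq> {n..}" for A
      using that by (simp add: f_def inf.absorb1)
    then have "subsums n \<subseteq> range f" by (auto simp only: subsums_def Pow_iff)
    ultimately show ?thesis by blast
  qed
  ultimately show ?thesis by simp
qed

text \<open>Only finitely many choices are made below \<open>n\<close>, so the set is a finite union
  of translates of a tail set, whose diameter is small for large \<open>n\<close>.\<close>

lemma subsums_decompose:
  assumes "k \<le> n"
  shows "subsums k = (\<Union>x\<in>sum a ` Pow {k..<n}. (+) x ` subsums n)"
proof (intro equalityI subsetI)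
  fix x assume "x \<in> subsums k"
  then obtain A where A: "A \<subseteq> {k..}" "x = infsum a A" by (auto simp: subsums_def)
  have "A \<inter> {..<n} \<in> Pow {k..<n}" "infsum a (A \<inter> {n..}) \<in> subsums n"
    using A by (auto simp: subsums_def)
  then show "x \<in> (\<Union>x\<in>sum a ` Pow {k..<n}. (+) x ` subsums n)"
    using infsum_split[of A n] A(2) by blast
next
  fix x assume "x \<in> (\<Union>x\<in>sum a ` Pow {k..<n}. (+) x ` subsums n)"
  then obtain F A where FA: "F \<subseteq> {k..<n}" "A \<subseteq> {n..}" "x = sum a F + infsum a A"
    by (auto simp: subsums_def)
  have "(F \<union> A) \<inter> {..<n} = F" "(F \<union> A) \<inter> {n..} = A" using FA by fastforce+
  then have "x = infsum a (F \<union> A)" using infsum_split[of "F \<union> A" n] FA by simp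
  moreover have "F \<union> A \<subseteq> {k..}" using FA assms by fastforce
  ultimately show "x \<in> subsums k" by (auto simp: subsums_def)
qed

lemma sum_in_subsums: "F \<subseteq> {k..<n} \<Longrightarrow> sum a F \<in> subsums k"
  unfolding subsums_def by (intro image_eqI[of _ _ F]) (auto simp: finite_subset)

text \<open>Complementing the index set reflects the set of subsums.\<close>

lemma remainder_minus_subsums:
  assumes "x \<in> subsums k"
  shows "remainder k - x \<in> subsums k"
proof -
  obtain A where A: "A \<subseteq> {k..}" "x = infsum a A" using assms by (auto simp: subsums_def)
  have "infsum a (A \<union> ({k..} - A)) = infsum a A + infsum a ({k..} - A)"
    by (intro infsum_Un_disjoint summable_on_any) auto
  moreover have "A \<union> ({k..} - A) = {k..}" using A by auto
  ultimately have "remainder k - x = infsum a ({k..} - A)" using A by (simp add: remainder_def)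
  then show ?thesis by (auto simp: subsums_def)
qed

text \<open>An index set either lies beyond \<open>i\<close> or contains some \<open>j\<close> up to
  \<open>i\<close>, whose term alone is at least \<open>a i\<close>.\<close>

lemma subsums_gap:
  assumes "\<And>j. k \<le> j \<Longrightarrow> j \<le> i \<Longrightarrow> a i \<le> a j" "x \<in> subsums k"
  shows "x \<le> remainder (Suc i) \<or> a i \<le> x"
proof -
  obtain A where A: "A \<subseteq> {k..}" "x = infsum a A" using assms(2) by (auto simp: subsums_def)
  show ?thesis
  proof (cases "A \<subseteq> {Suc i..}")
    case True
    then show ?thesis using A infsum_mono_set by (auto simp: remainder_def)
  next
    case False
    then obtain j where "j \<in> A" "j \<le> i" by force
    then have "a i \<le> a j" "a j \<le> x" using assms(1)[of j] A infsum_mono_set[of "{j}" A] by auto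
    then show ?thesis by linarith
  qed
qed

section \<open>Cantorvals from non-increasing series with infinitely many gaps\<close>

context
  assumes antimono: "\<And>i j. 1 \<le> i \<Longrightarrow> i \<le> j \<Longrightarrow> a j \<le> a i"
    and gaps: "infinite {i. remainder (Suc i) < a i}"
begin

text \<open>The gap at an index \<open>i\<close> with \<open>remainder (Suc i) < a i\<close> begins
  at \<open>remainder (Suc i)\<close>, which is close to 0 for late \<open>i\<close>.\<close>

lemma obtain_small_non_subsum:
  assumes "1 \<le> k" "0 < d"
  obtains t where "0 < t" "t < d" "t \<notin> subsums k"
proof -
  obtain N where N: "\<And>n. N \<le> n \<Longrightarrow> remainder n < d"
    using order_tendstoD(2)[OF remainder_tendsto_zero assms(2)] by (auto simp: eventually_sequentially)
  obtain i where i: "max k N \<le> i" "remainder (Suc i) < a i"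
    using gaps unfolding infinite_nat_iff_unbounded_le by blast
  have "remainder (Suc i) < min (a i) d" using N[of "Suc i"] i by simp
  then obtain t where t: "remainder (Suc i) < t" "t < min (a i) d" using dense by blast
  have "t \<notin> subsums k" using subsums_gap[of k i t] antimono[of _ i] assms(1) t by fastforce
  moreover have "0 < t" using t remainder_nonneg[of "Suc i"] by linarith
  ultimately show ?thesis using that t by simp
qed

text \<open>Immediately to the right of such an \<open>x\<close> the set would coincide with a translate by \<open>x\<close> of the
  subsums of a tail, and those have gaps arbitrarily near 0.\<close>
lemma no_left_isolated_endpoint:
  assumes "0 < e" "subsums 1 \<inter> {x - e<..<x} = {}" "{x<..<x + e} \<subseteq> subsums 1"
  shows False
proof -
  obtain n where n: "1 \<le> n" "remainder n < e/2" using obtain_remainder_less[of "e/2"] assms(1) by auto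
  have "finite (sum a ` Pow {1..<n})" by simp
  \<comment> \<open>With \<open>d\<close> below the distance from \<open>x\<close> to every other
    partial sum, a point within \<open>d\<close> to the right of \<open>x\<close> can only come from
    a partial sum at or below \<open>x\<close>.\<close>
  then obtain d where d: "d > 0" "\<And>y. y \<in> sum a ` Pow {1..<n} \<Longrightarrow> y \<noteq> x \<Longrightarrow> d \<le> dist x y"
    using finite_set_avoid[of "sum a ` Pow {1..<n}" x] by blast
  obtain t where t: "0 < t" "t < min d (e/2)" "t \<notin> subsums n"
    using obtain_small_non_subsum[of n "min d (e/2)"] n d assms(1) by auto
  have "x + t \<in> subsums 1" using assms(3) t by auto
  then obtain f u where f: "f \<in> sum a ` Pow {1..<n}" and u: "u \<in> subsums n" and eq: "x + t = f + u"
    using subsums_decompose[OF n(1)] by auto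
  have ub: "0 \<le> u" "u < e/2" using subsums_bounds[OF u] n by auto
  have "f \<in> subsums 1" using f sum_in_subsums by auto
  then have "f \<notin> {x - e<..<x}" using assms(2) by blast
  \<comment> \<open>As \<open>f\<close> is within \<open>e\<close> of \<open>x\<close>, the empty
    interval on the left forces it to the right. It is not \<open>x\<close>, since then
    \<open>u = t\<close> would be a subsum; so it is at least \<open>x + d\<close>, which exceeds
    \<open>x + t\<close>.\<close>
  then have "x \<le> f" using eq ub t assms(1) by auto
  moreover have "f \<noteq> x" using eq u t by auto
  ultimately show False using d(2)[OF f] eq ub t by (auto simp: dist_real_def)
qed

text \<open>The reflection \<open>x \<mapsto> remainder 1 - x\<close> preserves the set of subsums.\<close>
lemma no_right_isolated_endpoint:
  assumes "0 < e" "subsums 1 \<inter> {x<..<x + e} = {}" "{x - e<..<x} \<subseteq> subsums 1"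
  shows False
proof (rule no_left_isolated_endpoint)
  show "subsums 1 \<inter> {remainder 1 - x - e<..<remainder 1 - x} = {}"
    using assms(2) remainder_minus_subsums[of _ 1] by force
  show "{remainder 1 - x<..<remainder 1 - x + e} \<subseteq> subsums 1"
  proof
    fix y assume "y \<in> {remainder 1 - x<..<remainder 1 - x + e}"
    then have "remainder 1 - y \<in> subsums 1" using assms(3) by auto
    then show "y \<in> subsums 1" using remainder_minus_subsums by force
  qed
qed (fact assms(1))

theorem is_cantorval_achievement_set:
  assumes "interior (achievement_set a) \<noteq> {}"
  shows "is_cantorval (achievement_set a)"
proof -
  let ?E = "subsums 1"
  have int: "interior ?E \<noteq> {}" using assms by (simp add: achievement_set_eq)
  have cl: "closed ?E" by (rule compact_imp_closed[OF compact_subsums])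
  have tail_int: "interior (subsums n) \<noteq> {}" if "1 \<le> n" for n
    using interior_translates[of "sum a ` Pow {1..<n}" "subsums n"] int subsums_decompose[OF that]
      compact_imp_closed[OF compact_subsums] by simp
  have "?E \<subseteq> closure (interior ?E)"
  proof
    fix x assume x: "x \<in> ?E"
    have "\<exists>y\<in>interior ?E. dist y x < e" if "0 < e" for e
    proof -
      obtain n where n: "1 \<le> n" "remainder n < e" using obtain_remainder_less[OF \<open>0 < e\<close>] .
      from x obtain f u where f: "f \<in> sum a ` Pow {1..<n}" and u: "u \<in> subsums n" and eq: "x = f + u"
        using subsums_decompose[OF n(1)] by auto
      obtain v where v: "v \<in> interior (subsums n)" using tail_int[OF n(1)] by blast
      \<comment> \<open>This translate contains \<open>x\<close>, has diameter below
        \<open>e\<close> and has interior points.\<close>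
      have "(+) f ` subsums n \<subseteq> ?E" using subsums_decompose[OF n(1)] f by blast
      then have "f + v \<in> interior ?E"
        using v interior_mono interior_translation[of f "subsums n"] by blast
      moreover have "v \<in> subsums n" using v interior_subset by blast
      then have "dist (f + v) x < e"
        using subsums_bounds[OF u] subsums_bounds[of v n] n eq by (auto simp: dist_real_def)
      ultimately show ?thesis by blast
    qed
    then show "x \<in> closure (interior ?E)" by (simp add: closure_approachable)
  qed
  then have regular: "?E = closure (interior ?E)"
    using closure_mono[OF interior_subset[of ?E]] closure_closed[OF cl] by blast
  have "is_cantor_set (frontier ?E)"
  proof (rule is_cantor_setI)
    show "compact (frontier ?E)" by (rule compact_frontier[OF compact_subsums])
    show "interior (frontier ?E) = {}"
      using interior_mono[OF frontier_subset_closed[OF cl]] interior_subset[of "frontier ?E"]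
      by (auto simp: frontier_def)
    have "0 \<in> ?E" using sum_in_subsums[of "{}"] by simp
    moreover have "?E \<noteq> UNIV" using compact_subsums[of 1] not_compact_UNIV by metis
    ultimately show "frontier ?E \<noteq> {}" using frontier_eq_empty[of ?E] by blast
  next
    fix x assume x: "x \<in> frontier ?E"
    then have xE: "x \<in> ?E" "x \<notin> interior ?E" using cl by (auto simp: frontier_def closure_closed)
    show "x islimpt frontier ?E"
    proof (rule ccontr)
      assume "\<not> x islimpt frontier ?E"
      then obtain e where e: "0 < e" "\<And>y. y \<in> frontier ?E \<Longrightarrow> y \<noteq> x \<Longrightarrow> e \<le> \<bar>y - x\<bar>"
        unfolding islimpt_approachable dist_real_def by (meson not_le)
      \<comment> \<open>A connected set meeting both \<open>?E\<close> and its complement meets the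
        frontier, but \<open>x\<close> is the only frontier point nearby. Of the four resulting
        combinations, two full sides make \<open>x\<close> interior, two empty sides contradict
        regularity, and the mixed ones are the isolated end points already excluded.\<close>
      have one_side: "I \<subseteq> ?E \<or> ?E \<inter> I = {}" if "connected I" "I \<subseteq> {x - e<..<x + e} - {x}" for I
        using connected_Int_frontier[OF that(1), of ?E] e(2) that(2) by fastforce
      have l: "{x - e<..<x} \<subseteq> ?E \<or> ?E \<inter> {x - e<..<x} = {}" by (intro one_side) auto
      have r: "{x<..<x + e} \<subseteq> ?E \<or> ?E \<inter> {x<..<x + e} = {}" by (intro one_side) auto
      have "\<not> ({x - e<..<x} \<subseteq> ?E \<and> {x<..<x + e} \<subseteq> ?E)"
      proof
        assume "{x - e<..<x} \<subseteq> ?E \<and> {x<..<x + e} \<subseteq> ?E"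
        then have "{x - e<..<x + e} \<subseteq> ?E" using xE(1) by force
        then have "{x - e<..<x + e} \<subseteq> interior ?E" by (intro interior_maximal) auto
        moreover have "x \<in> {x - e<..<x + e}" using e(1) by simp
        ultimately show False using xE(2) by blast
      qed
      moreover have "\<not> (?E \<inter> {x - e<..<x} = {} \<and> ?E \<inter> {x<..<x + e} = {})"
      proof
        assume emp: "?E \<inter> {x - e<..<x} = {} \<and> ?E \<inter> {x<..<x + e} = {}"
        have "x \<in> closure (interior ?E)" using regular xE(1) by blast
        then obtain y where y: "y \<in> interior ?E" "dist y x < e"
          using e(1) by (auto simp: closure_approachable)
        then have "y \<in> ?E" "y \<noteq> x" using interior_subset xE(2) by blast+
        then have "y \<notin> {x - e<..<x}" "y \<notin> {x<..<x + e}" using emp by blast+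
        then show False using \<open>y \<noteq> x\<close> y(2) by (auto simp: dist_real_def)
      qed
      ultimately show False
        using l r no_left_isolated_endpoint[OF e(1)] no_right_isolated_endpoint[OF e(1)] by blast
    qed
  qed
  then show ?thesis
    using regular compact_imp_bounded[OF compact_subsums] by (simp add: is_cantorval_def achievement_set_eq)
qed

end

end

section \<open>The sequence with digits 3 and 5\<close>

text \<open>The element of \<open>B\<close> numbered \<open>n + 1\<close> comes only after
  \<open>m\<close> has reached \<open>(n + 1)^2\<close> for good. The square makes the quotient of
  the count by \<open>m n\<close> at most 1 over the root of \<open>m n\<close>.\<close>

lemma sparse_set_exists:
  fixes m :: "nat \<Rightarrow> nat"
  assumes "filterlim m at_top sequentially"
  shows "\<exists>B. infinite B \<and> infinite (- B) \<and> (\<forall>n. (card {i \<in> B. i \<le> n})\<^sup>2 \<le> m n)"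
proof -
  have ev: "\<exists>N. \<forall>k\<ge>N. c \<le> m k" for c
    using assms by (simp add: filterlim_at_top eventually_sequentially)
  \<comment> \<open>Choosing even numbers leaves all odd ones in the complement, which must be
    infinite too.\<close>
  have step: "\<exists>y. (even y \<and> (\<forall>k\<ge>y. (Suc n)\<^sup>2 \<le> m k)) \<and> x < y" for n x :: nat
  proof -
    obtain N where "\<forall>k\<ge>N. (Suc n)\<^sup>2 \<le> m k" using ev by blast
    then show ?thesis by (intro exI[of _ "2 * (N + x + 1)"]) auto
  qed
  have "\<exists>b. \<forall>n. (even (b n) \<and> (\<forall>k\<ge>b n. (Suc n)\<^sup>2 \<le> m k)) \<and> b n < b (Suc n)"
    by (rule dependent_nat_choice) (use step in blast)+
  then obtain b where b: "\<And>n. even (b n)" "\<And>n k. b n \<le> k \<Longrightarrow> (Suc n)\<^sup>2 \<le> m k"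
    "\<And>n. b n < b (Suc n)" by blast
  have sm: "strict_mono b" using b(3) by (simp add: strict_mono_Suc_iff)
  have "infinite (range b)" using sm strict_mono_imp_inj_on range_inj_infinite by blast
  moreover have "infinite (- range b)"
  proof (rule infinite_super)
    show "range (\<lambda>n. 2 * n + 1) \<subseteq> - range b" using b(1) by (auto simp: image_iff) (metis even_Suc even_mult_iff dvd_refl)
    show "infinite (range (\<lambda>n::nat. 2 * n + 1))" by (intro range_inj_infinite) (auto simp: inj_def)
  qed
  moreover have "(card {i \<in> range b. i \<le> n})\<^sup>2 \<le> m n" for n
  proof -
    let ?K = "{j. b j \<le> n}"
    have "?K \<subseteq> {..n}" using strict_mono_imp_increasing[OF sm] by (auto intro: order_trans)
    then have fin: "finite ?K" using finite_subset by blast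
    have "{i \<in> range b. i \<le> n} = b ` ?K" by auto
    then have card: "card {i \<in> range b. i \<le> n} \<le> card ?K" using card_image_le[OF fin] by simp
    show ?thesis
    proof (cases "?K = {}")
      case True
      then have "{i \<in> range b. i \<le> n} = {}" by auto
      then show ?thesis by (simp only: card.empty) simp
    next
      case False
      have "card ?K \<le> card {..Max ?K}" using fin by (intro card_mono) auto
      then have "(card {i \<in> range b. i \<le> n})\<^sup>2 \<le> (Suc (Max ?K))\<^sup>2" using card by (intro power_mono) auto
      also have "\<dots> \<le> m n" using Max_in[OF fin False] b(2) by blast
      finally show ?thesis .
    qed
  qed
  ultimately show ?thesis by blast
qed

definition digit_seq :: "nat set \<Rightarrow> nat \<Rightarrow> real" where
  "digit_seq B i = (if i \<in> B then 3 else 5) / 2 ^ i"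

lemma digit_seq_pos: "0 < digit_seq B i"
  by (simp add: digit_seq_def)

text \<open>The ratio 5/3 of the digits is below 2, so halving outweighs a change from 3 to
  5.\<close>

lemma digit_seq_antimono: "i \<le> j \<Longrightarrow> digit_seq B j \<le> digit_seq B i"
  by (rule lift_Suc_antimono_le[of "digit_seq B"]) (auto simp: digit_seq_def field_simps)

text \<open>The constant digit 5 majorizes every \<open>digit_seq B\<close>, and its tail after
  \<open>i\<close> equals its term at \<open>i\<close>.\<close>

lemma geometric_has_sum: "((\<lambda>i. 5 / 2 ^ i :: real) has_sum 10 / 2 ^ n) {n..}"
proof -
  have "(\<lambda>i. 5 / 2 ^ n * (1/2) ^ i :: real) sums (5 / 2 ^ n * (1 / (1 - 1/2)))"
    by (intro sums_mult geometric_sums) simp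
  then have "((\<lambda>i. 5 / 2 ^ n * (1/2) ^ i :: real) has_sum (10 / 2 ^ n)) UNIV"
    by (intro sums_nonneg_imp_has_sum) auto
  also have "?this \<longleftrightarrow> ?thesis"
    by (rule has_sum_reindex_bij_witness[of _ "\<lambda>i. i - n" "\<lambda>i. i + n"])
       (auto simp: power_add power_divide)
  finally show ?thesis .
qed

interpretation digit_seq: nonneg_series "digit_seq B" for B
proof
  have "(\<lambda>i. 5 / 2 ^ i :: real) summable_on {0..}"
    using geometric_has_sum[of 0] has_sum_imp_summable by blast
  then show "digit_seq B summable_on UNIV"
    unfolding atLeast_0
    by (rule summable_on_comparison_test) (simp_all add: digit_seq_def divide_right_mono)
qed (simp add: digit_seq_def)

lemma remainder_digit_seq_le: "digit_seq.remainder B n \<le> 10 / 2 ^ n"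
  unfolding digit_seq.remainder_def
  by (rule has_sum_mono[OF has_sum_infsum[OF digit_seq.summable_on_any] geometric_has_sum])
     (auto simp: digit_seq_def divide_right_mono)

lemma remainder_digit_seq_less:
  assumes "infinite B" "i \<notin> B"
  shows "digit_seq.remainder B (Suc i) < digit_seq B i"
proof -
  \<comment> \<open>A later digit 3 makes the comparison with the constant digit 5 strict.\<close>
  obtain j where j: "j \<in> B" "i < j" using assms(1) by (auto simp: infinite_nat_iff_unbounded)
  have "digit_seq.remainder B (Suc i) < 10 / 2 ^ Suc i"
    unfolding digit_seq.remainder_def
  proof (rule has_sum_strict_mono[OF has_sum_infsum[OF digit_seq.summable_on_any] geometric_has_sum])
    show "j \<in> {Suc i..}" "digit_seq B j < 5 / 2 ^ j" using j by (auto simp: digit_seq_def divide_strict_right_mono)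
  qed (auto simp: digit_seq_def divide_right_mono)
  then show ?thesis using assms(2) by (simp add: digit_seq_def)
qed

text \<open>All digits are odd, so the last one can correct the parity of the numerator \<open>z\<close>.\<close>
lemma digit_seq_dyadic_mod_1:
  "\<exists>A\<subseteq>{1..n}. \<exists>w::int. sum (digit_seq B) A = of_int z / 2 ^ n + of_int w"
proof (induction n arbitrary: z)
  case 0
  then show ?case by (intro exI[of _ "{}"] conjI exI[of _ "- z"]) auto
next
  case (Suc n)
  define d :: int where "d = (if Suc n \<in> B then 3 else 5)"
  have "odd d" by (simp add: d_def)
  have dig: "digit_seq B (Suc n) = of_int d / 2 ^ Suc n" by (simp add: digit_seq_def d_def)
  show ?case
  proof (cases "even z")
    case True
    then obtain y where z: "z = 2 * y" by (elim evenE)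
    obtain A w where A: "A \<subseteq> {1..n}" "sum (digit_seq B) A = of_int y / 2 ^ n + of_int w"
      using Suc.IH[of y] by auto
    then show ?thesis by (intro exI[of _ A] conjI exI[of _ w]) (auto simp: z)
  next
    case False
    then have "even (z - d)" using \<open>odd d\<close> by simp
    then obtain y where z: "z - d = 2 * y" by (elim evenE)
    then have z': "z = 2 * y + d" by simp
    obtain A w where A: "A \<subseteq> {1..n}" "sum (digit_seq B) A = of_int y / 2 ^ n + of_int w"
      using Suc.IH[of y] by auto
    then have "finite A" "Suc n \<notin> A" using finite_subset by auto
    then have "sum (digit_seq B) (insert (Suc n) A) = of_int z / 2 ^ Suc n + of_int w"
      using A(2) by (simp add: dig z' add_divide_distrib)
    moreover have "insert (Suc n) A \<subseteq> {1..Suc n}" using A(1) by auto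
    ultimately show ?thesis by blast
  qed
qed

lemma interior_achievement_digit_seq: "interior (achievement_set (digit_seq B)) \<noteq> {}"
proof -
  let ?E = "digit_seq.subsums B 1"
  \<comment> \<open>If a subsum, which lies in [0, 5], differs from a point of [0, 1] by an integer
    \<open>w\<close>, then \<open>w\<close> is between -1 and 5; the translation is by
    \<open>- w\<close>.\<close>
  let ?X = "real_of_int ` {-5..1}"
  have cl: "closed ?E" by (rule compact_imp_closed[OF digit_seq.compact_subsums])
  define K where "K = (\<Union>x\<in>?X. (+) x ` ?E)"
  have "closed K" unfolding K_def by (intro closed_UN ballI closed_translation cl) simp
  have dyadic: "of_int z / 2 ^ n \<in> K" if "0 \<le> of_int z / (2::real) ^ n" "of_int z / (2::real) ^ n \<le> 1" for z n
  proof -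
    obtain A w where A: "A \<subseteq> {1..n}" "sum (digit_seq B) A = of_int z / 2 ^ n + of_int w"
      using digit_seq_dyadic_mod_1[of n B z] by auto
    have mem: "sum (digit_seq B) A \<in> ?E"
      using digit_seq.sum_in_subsums[of A 1 "Suc n" B] A(1) by (simp add: atLeastLessThanSuc_atLeastAtMost)
    then have "0 \<le> sum (digit_seq B) A" "sum (digit_seq B) A \<le> 5"
      using digit_seq.subsums_bounds[of _ B 1] remainder_digit_seq_le[of B 1] by force+
    then have "- 1 \<le> real_of_int w" "real_of_int w \<le> 5" using A(2) that by linarith+
    then have "- w \<in> {-5..1}" by auto
    then have "real_of_int (- w) \<in> ?X" by blast
    moreover have "of_int z / 2 ^ n = real_of_int (- w) + sum (digit_seq B) A" using A(2) by simp
    ultimately show ?thesis unfolding K_def using mem by blast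
  qed
  have "{0..1} \<subseteq> K"
  proof
    fix x :: real assume x: "x \<in> {0..1}"
    have "\<exists>y\<in>K. dist y x < e" if e: "0 < e" for e
    proof -
      obtain n where n: "(1/2) ^ n < e" using real_arch_pow_inv[OF e, of "1/2"] by auto
      \<comment> \<open>Rounding down to a dyadic number suffices because \<open>K\<close> is
        closed.\<close>
      define y where "y = of_int \<lfloor>x * 2 ^ n\<rfloor> / (2::real) ^ n"
      have "of_int \<lfloor>x * 2 ^ n\<rfloor> \<le> x * 2 ^ n" "x * 2 ^ n < of_int \<lfloor>x * 2 ^ n\<rfloor> + 1" by linarith+
      then have "y \<le> x" "x < y + (1/2) ^ n" by (simp_all add: y_def field_simps)
      moreover have "0 \<le> y" using x by (simp add: y_def)
      moreover have "y \<le> 1" using x \<open>y \<le> x\<close> by simp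
      ultimately have "y \<in> K" "dist y x < e"
        using n dyadic[of "\<lfloor>x * 2 ^ n\<rfloor>" n] by (simp_all only: y_def[symmetric]) (simp add: dist_real_def)
      then show ?thesis by blast
    qed
    then show "x \<in> K" using closed_approachable[OF \<open>closed K\<close>] by blast
  qed
  then have "interior {0..1::real} \<subseteq> interior K" by (rule interior_mono)
  then have "interior K \<noteq> {}" by (auto simp: interior_atLeastAtMost_real)
  then show ?thesis
    using interior_translates[of ?X ?E] cl by (simp add: K_def digit_seq.achievement_set_eq)
qed

theorem theorem7:
  fixes m :: "nat \<Rightarrow> nat"
  assumes "\<And>n. n \<ge> 1 \<Longrightarrow> m n > 0"
    and "filterlim m at_top sequentially"
  shows "\<exists>a :: nat \<Rightarrow> real.
           (\<forall>n\<ge>1. a n > 0) \<and>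
           (\<forall>i\<ge>1. \<forall>j\<ge>i. a j \<le> a i) \<and>
           a summable_on {1..} \<and>
           is_cantorval (achievement_set a) \<and>
           (\<lambda>n. real (card {i. 1 \<le> i \<and> i \<le> n \<and> a i \<le> tail_sum a i}) / real (m n))
             \<longlonglongrightarrow> 0"
proof -
  obtain B where B: "infinite B" "infinite (- B)" "\<And>n. (card {i \<in> B. i \<le> n})\<^sup>2 \<le> m n"
    using sparse_set_exists[OF assms(2)] by blast
  let ?a = "digit_seq B"
  let ?c = "\<lambda>n. card {i. 1 \<le> i \<and> i \<le> n \<and> ?a i \<le> tail_sum ?a i}"
  have "- B \<subseteq> {i. digit_seq.remainder B (Suc i) < ?a i}"
    using remainder_digit_seq_less[OF B(1)] by blast
  then have "infinite {i. digit_seq.remainder B (Suc i) < ?a i}" using B(2) finite_subset by blast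
  then have "is_cantorval (achievement_set ?a)"
    using digit_seq.is_cantorval_achievement_set[of B] digit_seq_antimono interior_achievement_digit_seq
    by blast
  moreover have "(\<lambda>n. real (?c n) / real (m n)) \<longlonglongrightarrow> 0"
  proof (rule tendsto_sandwich[OF _ _ tendsto_const])
    \<comment> \<open>Only indices in \<open>B\<close> are counted. The bound also holds where
      \<open>m n = 0\<close>, both quotients then being 0.\<close>
    have "real (?c n) / real (m n) \<le> 1 / sqrt (real (m n))" for n
    proof -
      have "i \<in> B" if "?a i \<le> tail_sum ?a i" for i
        using that remainder_digit_seq_less[OF B(1)] by (force simp: digit_seq.tail_sum_eq)
      then have "?c n \<le> card {i \<in> B. i \<le> n}" by (intro card_mono) auto
      then have "(?c n)\<^sup>2 \<le> m n" using B(3)[of n] power_mono order_trans by blast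
      then have "real (?c n) \<le> sqrt (real (m n))"
        by (intro real_le_rsqrt) (metis of_nat_le_iff of_nat_power)
      then have "real (?c n) / real (m n) \<le> sqrt (real (m n)) / real (m n)"
        by (intro divide_right_mono) auto
      then show ?thesis by (simp add: sqrt_divide_self_eq inverse_eq_divide)
    qed
    then show "\<forall>\<^sub>F n in sequentially. real (?c n) / real (m n) \<le> 1 / sqrt (real (m n))" by simp
    have "filterlim (\<lambda>n. sqrt (real (m n))) at_top sequentially"
      by (intro filterlim_compose[OF sqrt_at_top] filterlim_compose[OF filterlim_real_sequentially] assms(2))
    then show "(\<lambda>n. 1 / sqrt (real (m n))) \<longlonglongrightarrow> 0"
      by (intro real_tendsto_divide_at_top[OF tendsto_const])
  qed simp
  ultimately show ?thesis
    using digit_seq_pos digit_seq_antimono digit_seq.summable_on_any by blast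
qed

end
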